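(* Let $a_1+a_2=1$ with $|a_2|<1$, and let $X$ be the AR(2)-process with these coefficients. Assume $\mathbb{E}[Y_1]=0$ and $\mathbb{E}[Y_1^2]\in(0,\infty)$. (1) If $a_2>0$, then $p_N(x)\precsim N^{-1/2}$ for all $x\ge0$. (2) If $a_2<0$, then $p_N(x)\succsim N^{-1/2}$ for all $x\ge0$.
   Context: Let $(Y_n)_{n\ge1}$ be i.i.d. nondegenerate real random variables. The AR(2)-process is $X_n=a_1X_{n-1}+a_2X_{n-2}+Y_n$ for $n\ge1$ with $X_n=0$ for $n\le0$; $p_N(x):=\mathbb{P}(\sup_{n=1,\dots,N}X_n\le x)$. $f\precsim g$ means $\limsup_{N\to\infty} f(N)/g(N)<\infty$; $f\succsim g$ means $g\precsim f$. *)

theory Defs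
  imports "HOL-Probability.Probability" "HOL-Library.Landau_Symbols"
begin

text \<open>AR(2)-process X_n = a1 X_{n-1} + a2 X_{n-2} + Y_n for n \<ge> 1, with X_n = 0 for n \<le> 0.
  Indices n \<le> 0 are represented by the single value index 0 (X_0 = 0, and X_{-1} = 0 is
  built into the equation for X_1). The innovations are Y 1, Y 2, ...; Y 0 is unused.\<close>
fun ar2 :: "real \<Rightarrow> real \<Rightarrow> (nat \<Rightarrow> 'a \<Rightarrow> real) \<Rightarrow> nat \<Rightarrow> 'a \<Rightarrow> real" where
  "ar2 a1 a2 Y 0 \<omega> = 0"
| "ar2 a1 a2 Y (Suc 0) \<omega> = a1 * ar2 a1 a2 Y 0 \<omega> + Y 1 \<omega>"
| "ar2 a1 a2 Y (Suc (Suc n)) \<omega> =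
     a1 * ar2 a1 a2 Y (Suc n) \<omega> + a2 * ar2 a1 a2 Y n \<omega> + Y (Suc (Suc n)) \<omega>"

definition persist_prob :: "'a measure \<Rightarrow> real \<Rightarrow> real \<Rightarrow> (nat \<Rightarrow> 'a \<Rightarrow> real) \<Rightarrow> nat \<Rightarrow> real \<Rightarrow> real" where
  "persist_prob M a1 a2 Y N x =
     measure M {\<omega> \<in> space M. \<forall>n\<in>{1..N}. ar2 a1 a2 Y n \<omega> \<le> x}"

end

theory Submission
  imports Defs
begin

text \<open>
  Since \<open>a1 + a2 = 1\<close>, the combination \<open>S n = X n + a2 * X (n - 1)\<close> is the random walk with steps
  \<open>Y\<close>. For \<open>a2 > 0\<close>, \<open>X \<le> x\<close> up to time \<open>N\<close> forces \<open>S \<le> (1 + a2) * x\<close> up to time \<open>N\<close>; for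
  \<open>a2 < 0\<close>, \<open>S \<le> 0\<close> up to time \<open>N\<close> forces \<open>X \<le> 0\<close> up to time \<open>N\<close>. So it suffices to bound the
  persistence probabilities of \<open>S\<close> on both sides.

  Let \<open>r n\<close> be the probability that \<open>S\<close> stays positive up to time \<open>n\<close>. On this event the
  expectation of \<open>S n\<close> is nondecreasing in \<open>n\<close>, hence at least \<open>E[max 0 (Y 1)] > 0\<close>, while that of
  \<open>(S n)\<^sup>2\<close> is at most \<open>E[(Y 1)\<^sup>2] * (\<Sum>k<n. r k)\<close>. By Cauchy-Schwarz \<open>r n * (\<Sum>k<n. r k)\<close> is bounded
  away from 0, so the square of \<open>R n = (\<Sum>k<n. r k)\<close> grows at least linearly. If \<open>q n\<close> is the
  probability that \<open>S\<close> stays nonpositive up to time \<open>n\<close>, then splitting at the first time at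
  which the maximum is attained, and reversing time before it, gives
  \<open>(\<Sum>k\<le>n. r k * q (n - k)) \<le> 1\<close>, hence \<open>q n \<le> 1 / R (n + 1)\<close>, which is of order \<open>n powr (-1/2)\<close>.
  The Cauchy-Schwarz bound applied to \<open>-Y\<close> says that \<open>q n * (\<Sum>k<n. q k)\<close> is bounded away from 0,
  and the upper bound on \<open>q\<close> turns this into a lower bound of the same order. A positive level is
  reduced to level 0 by finitely many downward steps.
\<close>

lemma discriminant_nonpos_if_nonneg:
  fixes V a p :: real
  assumes quad: "\<And>t. 0 \<le> V - 2 * t * a + t\<^sup>2 * p" and "V \<ge> 0" "p \<ge> 0"
  shows "a\<^sup>2 \<le> V * p"
proof (cases "p = 0")
  case True
  have "a = 0"
    using quad[of "(V + 1) / (2 * a)"] True by (cases "a = 0") auto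
  then show ?thesis using True by simp
next
  case False
  then have "p > 0" using \<open>p \<ge> 0\<close> by simp
  have "(a / p)\<^sup>2 * p = a\<^sup>2 / p" "2 * (a / p) * a = 2 * (a\<^sup>2 / p)"
    using False by (simp_all add: power2_eq_square)
  then have "a\<^sup>2 / p \<le> V" using quad[of "a / p"] by linarith
  then show ?thesis using \<open>p > 0\<close> by (simp add: pos_divide_le_eq)
qed

lemma sum_square_ge_linear:
  fixes r :: "nat \<Rightarrow> real"
  assumes "r 0 = 1" "r 1 \<le> 1" "\<kappa> > 0"
    and ge: "\<And>n. n \<ge> 1 \<Longrightarrow> \<kappa> \<le> r n * (\<Sum>k<n. r k)" and "n \<ge> 1"
  shows "\<kappa> * real n \<le> (\<Sum>k<n. r k)\<^sup>2"
  using \<open>n \<ge> 1\<close>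
proof (induction n rule: dec_induct)
  case base
  show ?case using ge[of 1] assms by simp
next
  case (step n)
  have "(\<Sum>k<Suc n. r k)\<^sup>2 = (\<Sum>k<n. r k)\<^sup>2 + 2 * (r n * (\<Sum>k<n. r k)) + (r n)\<^sup>2"
    by (simp add: power2_eq_square algebra_simps)
  then have "(\<Sum>k<Suc n. r k)\<^sup>2 \<ge> \<kappa> * real n + 2 * \<kappa>"
    using ge[OF step(1)] step.IH zero_le_power2[of "r n"] by linarith
  then show ?case using \<open>\<kappa> > 0\<close> by (simp add: algebra_simps)
qed

lemma sum_inverse_sqrt_le: "(\<Sum>k<n. 1 / sqrt (real k + 1)) \<le> 2 * sqrt (real n)"
proof (induction n)
  case (Suc n)
  let ?a = "sqrt (real n)" and ?b = "sqrt (real n + 1)"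
  have "?b > 0" by simp
  have "2 * ?a * ?b \<le> ?a\<^sup>2 + ?b\<^sup>2"
    using zero_le_power2[of "?a - ?b"] by (simp add: power2_diff)
  then have "2 * ?a * ?b + 1 \<le> 2 * (?b * ?b)"
    by simp
  then have "2 * ?a + 1 / ?b \<le> 2 * ?b"
    using \<open>?b > 0\<close> by (simp add: field_simps)
  with Suc show ?case by (simp add: add.commute)
qed simp

locale iid_walk = prob_space M for M :: "'a measure" +
  fixes Y :: "nat \<Rightarrow> 'a \<Rightarrow> real"
  assumes indep: "indep_vars (\<lambda>_. borel) Y {1..}"
    and ident: "\<And>n. n \<ge> 1 \<Longrightarrow> distr M borel (Y n) = distr M borel (Y 1)"
    and integrable_Y1: "integrable M (Y 1)"
    and mean_zero: "expectation (Y 1) = 0"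
    and integrable_Y1_sq: "integrable M (\<lambda>\<omega>. (Y 1 \<omega>)\<^sup>2)"
    and var_pos: "expectation (\<lambda>\<omega>. (Y 1 \<omega>)\<^sup>2) > 0"
begin

text \<open>Otherwise \<open>Y 1\<close> in the assumptions would be rewritten to \<open>Y (Suc 0)\<close>.\<close>
declare One_nat_def [simp del]

definition walk :: "nat \<Rightarrow> 'a \<Rightarrow> real" where
  "walk n \<omega> = (\<Sum>i\<in>{1..n}. Y i \<omega>)"

definition stay :: "real set \<Rightarrow> nat \<Rightarrow> 'a set" where
  "stay I n = {\<omega> \<in> space M. \<forall>k\<in>{1..n}. walk k \<omega> \<in> I}"

lemma walk_0 [simp]: "walk 0 \<omega> = 0"
  by (simp add: walk_def)

lemma walk_Suc: "walk (Suc n) \<omega> = walk n \<omega> + Y (Suc n) \<omega>"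
  by (simp add: walk_def)

lemma measurable_Y: "n \<ge> 1 \<Longrightarrow> Y n \<in> borel_measurable M"
  using indep by (auto simp: indep_vars_def2)

lemma measurable_walk [measurable]: "walk n \<in> borel_measurable M"
  unfolding walk_def by (intro borel_measurable_sum measurable_Y) simp

lemma sets_stay [measurable]: "I \<in> sets borel \<Longrightarrow> stay I n \<in> events"
  unfolding stay_def by (intro sets.sets_Collect_finite_All) auto

lemma stay_0 [simp]: "stay I 0 = space M"
  by (simp add: stay_def)

lemma stay_Suc: "stay I (Suc n) = {\<omega> \<in> stay I n. walk (Suc n) \<omega> \<in> I}"
  by (auto simp: stay_def atLeastAtMostSuc_conv)

lemma integrable_Y_transfer:
  fixes h :: "real \<Rightarrow> real"
  assumes "n \<ge> 1" and [measurable]: "h \<in> borel_measurable borel"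
  shows "integrable M (\<lambda>\<omega>. h (Y n \<omega>)) \<longleftrightarrow> integrable M (\<lambda>\<omega>. h (Y 1 \<omega>))"
  using integrable_distr_eq[OF measurable_Y[OF assms(1)] assms(2)]
    integrable_distr_eq[OF measurable_Y[of 1] assms(2)] ident[OF assms(1)] by simp

lemma expectation_Y_transfer:
  fixes h :: "real \<Rightarrow> real"
  assumes "n \<ge> 1" and [measurable]: "h \<in> borel_measurable borel"
  shows "expectation (\<lambda>\<omega>. h (Y n \<omega>)) = expectation (\<lambda>\<omega>. h (Y 1 \<omega>))"
  using integral_distr[OF measurable_Y[OF assms(1)] assms(2)]
    integral_distr[OF measurable_Y[of 1] assms(2)] ident[OF assms(1)] by simp

lemma measurable_partial_sum [measurable]:
  assumes "{a..b} \<subseteq> A"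
  shows "(\<lambda>f. \<Sum>i\<in>{a..b}. f i :: real) \<in> borel_measurable (PiM A (\<lambda>_. borel))"
  using assms by (intro borel_measurable_sum measurable_component_singleton) auto

lemma
  fixes Z :: "'a \<Rightarrow> real"
  assumes Z: "\<And>\<omega>. Z \<omega> = F (\<lambda>i\<in>{1..n}. Y i \<omega>)"
    and F: "F \<in> borel_measurable (PiM {1..n} (\<lambda>_. borel))"
    and h [measurable]: "h \<in> borel_measurable borel"
    and "integrable M Z" and "integrable M (\<lambda>\<omega>. h (Y 1 \<omega>))"
  shows expectation_past_mult_next:
      "expectation (\<lambda>\<omega>. Z \<omega> * h (Y (Suc n) \<omega>)) = expectation Z * expectation (\<lambda>\<omega>. h (Y 1 \<omega>))"
    and integrable_past_mult_next: "integrable M (\<lambda>\<omega>. Z \<omega> * h (Y (Suc n) \<omega>))"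
proof -
  have "indep_var borel (F \<circ> (\<lambda>\<omega>. \<lambda>i\<in>{1..n}. Y i \<omega>))
      borel ((\<lambda>f. h (f (Suc n))) \<circ> (\<lambda>\<omega>. \<lambda>i\<in>{Suc n}. Y i \<omega>))"
    by (intro indep_var_compose[OF indep_var_restrict[OF indep]] F) auto
  then have ind: "indep_var borel Z borel (\<lambda>\<omega>. h (Y (Suc n) \<omega>))"
    by (simp add: o_def Z[abs_def])
  have int: "integrable M (\<lambda>\<omega>. h (Y (Suc n) \<omega>))"
    using assms by (subst integrable_Y_transfer) auto
  show "expectation (\<lambda>\<omega>. Z \<omega> * h (Y (Suc n) \<omega>)) = expectation Z * expectation (\<lambda>\<omega>. h (Y 1 \<omega>))"
    using indep_var_lebesgue_integral[OF ind assms(4) int]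
      expectation_Y_transfer[of "Suc n" h] by simp
  show "integrable M (\<lambda>\<omega>. Z \<omega> * h (Y (Suc n) \<omega>))"
    by (rule indep_var_integrable[OF ind assms(4) int])
qed

lemma square_integrable_walk: "integrable M (\<lambda>\<omega>. (walk n \<omega>)\<^sup>2)"
proof (induction n)
  case (Suc n)
  have "integrable M (walk n)"
    by (rule square_integrable_imp_integrable) (use Suc in auto)
  then have "integrable M (\<lambda>\<omega>. walk n \<omega> * Y (Suc n) \<omega>)"
    using integrable_Y1
    by (intro integrable_past_mult_next[where h = "\<lambda>y. y" and F = "\<lambda>f. \<Sum>i\<in>{1..n}. f i"]
        measurable_partial_sum) (simp add: walk_def, auto)
  moreover have "integrable M (\<lambda>\<omega>. (Y (Suc n) \<omega>)\<^sup>2)"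
    using integrable_Y1_sq integrable_Y_transfer[of "Suc n" "\<lambda>y. y\<^sup>2"] by simp
  ultimately show ?case
    using Suc by (simp add: walk_Suc power2_sum mult.assoc)
qed simp

lemma integrable_walk: "integrable M (walk n)"
  by (rule square_integrable_imp_integrable) (use square_integrable_walk in auto)

lemma
  assumes I [measurable]: "I \<in> sets borel"
  shows expectation_walk_Suc_stay:
      "expectation (\<lambda>\<omega>. walk (Suc n) \<omega> * indicator (stay I n) \<omega>)
        = expectation (\<lambda>\<omega>. walk n \<omega> * indicator (stay I n) \<omega>)"
    and expectation_walk_Suc_sq_stay:
      "expectation (\<lambda>\<omega>. (walk (Suc n) \<omega>)\<^sup>2 * indicator (stay I n) \<omega>)
        = expectation (\<lambda>\<omega>. (walk n \<omega>)\<^sup>2 * indicator (stay I n) \<omega>)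
          + expectation (\<lambda>\<omega>. (Y 1 \<omega>)\<^sup>2) * prob (stay I n)"
proof -
  let ?J = "\<lambda>\<omega>. if \<forall>k\<in>{1..n}. walk k \<omega> \<in> I then 1 else 0 :: real"
  let ?G = "\<lambda>f. if \<forall>k\<in>{1..n}. (\<Sum>i\<in>{1..k}. f i) \<in> I then 1 else 0 :: real"
  have ind: "indicator (stay I n) \<omega> = ?J \<omega>" if "\<omega> \<in> space M" for \<omega>
    using that by (auto simp: stay_def indicator_def)
  have [measurable]: "(\<lambda>f. \<Sum>i\<in>{1..k}. f i :: real) \<in> borel_measurable (PiM {1..n} (\<lambda>_. borel))"
    if "k \<in> {1..n}" for k
    using that by (intro measurable_partial_sum) auto
  have [measurable]: "(\<lambda>f. \<Sum>i\<in>{1..n}. f i :: real) \<in> borel_measurable (PiM {1..n} (\<lambda>_. borel))"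
    by (intro measurable_partial_sum) auto
  have G [measurable]: "?G \<in> borel_measurable (PiM {1..n} (\<lambda>_. borel))"
    by measurable
  have JG: "?J \<omega> = ?G (\<lambda>i\<in>{1..n}. Y i \<omega>)" for \<omega>
    by (simp add: walk_def)
  have intJ: "integrable M ?J"
    by (rule integrable_const_bound[of _ 1]) auto
  have J: "integrable M (\<lambda>\<omega>. f \<omega> * ?J \<omega>)" if "integrable M f" for f :: "'a \<Rightarrow> real"
    using that by (rule Bochner_Integration.integrable_bound) (use that in auto)
  have pJ: "expectation ?J = prob (stay I n)"
    using Bochner_Integration.integral_cong[of M M ?J "indicator (stay I n)"] ind by simp
  note past = expectation_past_mult_next integrable_past_mult_next
  have 1: "expectation (\<lambda>\<omega>. ?J \<omega> * Y (Suc n) \<omega>) = expectation ?J * expectation (\<lambda>\<omega>. Y 1 \<omega>)"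
      "integrable M (\<lambda>\<omega>. ?J \<omega> * Y (Suc n) \<omega>)"
    by (rule past[where h = "\<lambda>y. y", OF JG G _ intJ]; simp add: integrable_Y1)+
  have 2: "expectation (\<lambda>\<omega>. ?J \<omega> * (Y (Suc n) \<omega>)\<^sup>2) = expectation ?J * expectation (\<lambda>\<omega>. (Y 1 \<omega>)\<^sup>2)"
      "integrable M (\<lambda>\<omega>. ?J \<omega> * (Y (Suc n) \<omega>)\<^sup>2)"
    by (rule past[where h = "\<lambda>y. y\<^sup>2", OF JG G _ intJ]; simp add: integrable_Y1_sq[simplified])+
  let ?F = "\<lambda>f. (\<Sum>i\<in>{1..n}. f i) * ?G f"
  have F: "?F \<in> borel_measurable (PiM {1..n} (\<lambda>_. borel))"
    by measurable
  have JF: "walk n \<omega> * ?J \<omega> = ?F (\<lambda>i\<in>{1..n}. Y i \<omega>)" for \<omega>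
    by (simp add: walk_def)
  have 3: "expectation (\<lambda>\<omega>. walk n \<omega> * ?J \<omega> * Y (Suc n) \<omega>)
        = expectation (\<lambda>\<omega>. walk n \<omega> * ?J \<omega>) * expectation (\<lambda>\<omega>. Y 1 \<omega>)"
      "integrable M (\<lambda>\<omega>. walk n \<omega> * ?J \<omega> * Y (Suc n) \<omega>)"
    by (rule past[where h = "\<lambda>y. y", OF JF F _ J[OF integrable_walk]]; simp add: integrable_Y1)+
  have "expectation (\<lambda>\<omega>. walk (Suc n) \<omega> * indicator (stay I n) \<omega>)
      = expectation (\<lambda>\<omega>. walk n \<omega> * ?J \<omega> + ?J \<omega> * Y (Suc n) \<omega>)"
    by (rule Bochner_Integration.integral_cong) (simp_all only: ind walk_Suc algebra_simps)
  also have "\<dots> = expectation (\<lambda>\<omega>. walk n \<omega> * ?J \<omega>)"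
    by (subst Bochner_Integration.integral_add[OF J[OF integrable_walk] 1(2)])
       (simp only: 1(1) mean_zero mult_zero_right add_0_right)
  also have "\<dots> = expectation (\<lambda>\<omega>. walk n \<omega> * indicator (stay I n) \<omega>)"
    by (rule Bochner_Integration.integral_cong) (simp_all only: ind)
  finally show "expectation (\<lambda>\<omega>. walk (Suc n) \<omega> * indicator (stay I n) \<omega>)
        = expectation (\<lambda>\<omega>. walk n \<omega> * indicator (stay I n) \<omega>)" .
  have "expectation (\<lambda>\<omega>. (walk (Suc n) \<omega>)\<^sup>2 * indicator (stay I n) \<omega>)
      = expectation (\<lambda>\<omega>. ((walk n \<omega>)\<^sup>2 * ?J \<omega> + 2 * (walk n \<omega> * ?J \<omega> * Y (Suc n) \<omega>))
          + ?J \<omega> * (Y (Suc n) \<omega>)\<^sup>2)"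
    by (rule Bochner_Integration.integral_cong)
       (simp_all only: ind walk_Suc power2_eq_square algebra_simps mult_2)
  also have "\<dots> = expectation (\<lambda>\<omega>. (walk n \<omega>)\<^sup>2 * ?J \<omega>)
      + expectation (\<lambda>\<omega>. (Y 1 \<omega>)\<^sup>2) * prob (stay I n)"
    by (subst Bochner_Integration.integral_add, intro Bochner_Integration.integrable_add
          integrable_mult_right J[OF square_integrable_walk] 3(2), rule 2(2),
        subst Bochner_Integration.integral_add, rule J[OF square_integrable_walk],
        intro integrable_mult_right 3(2))
       (simp only: integral_mult_right_zero 2(1) 3(1) mean_zero pJ, simp)
  also have "expectation (\<lambda>\<omega>. (walk n \<omega>)\<^sup>2 * ?J \<omega>)
      = expectation (\<lambda>\<omega>. (walk n \<omega>)\<^sup>2 * indicator (stay I n) \<omega>)"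
    by (rule Bochner_Integration.integral_cong) (simp_all only: ind)
  finally show "expectation (\<lambda>\<omega>. (walk (Suc n) \<omega>)\<^sup>2 * indicator (stay I n) \<omega>)
        = expectation (\<lambda>\<omega>. (walk n \<omega>)\<^sup>2 * indicator (stay I n) \<omega>)
          + expectation (\<lambda>\<omega>. (Y 1 \<omega>)\<^sup>2) * prob (stay I n)" .
qed

lemma expectation_walk_stay_ge:
  assumes I [measurable]: "I \<in> sets borel" and out: "\<And>x. x \<notin> I \<Longrightarrow> x \<le> 0" and "n \<ge> 1"
  shows "expectation (\<lambda>\<omega>. Y 1 \<omega> * indicator I (Y 1 \<omega>))
    \<le> expectation (\<lambda>\<omega>. walk n \<omega> * indicator (stay I n) \<omega>)"
  using \<open>n \<ge> 1\<close>
proof (induction n rule: dec_induct)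
  case base
  have "expectation (\<lambda>\<omega>. Y 1 \<omega> * indicator I (Y 1 \<omega>))
    = expectation (\<lambda>\<omega>. walk 1 \<omega> * indicator (stay I 1) \<omega>)"
    by (rule Bochner_Integration.integral_cong) (auto simp: walk_def stay_def indicator_def)
  then show ?case by simp
next
  case (step n)
  have "expectation (\<lambda>\<omega>. walk (Suc n) \<omega> * indicator (stay I n) \<omega>)
    \<le> expectation (\<lambda>\<omega>. walk (Suc n) \<omega> * indicator (stay I (Suc n)) \<omega>)"
    by (intro integral_mono integrable_real_mult_indicator integrable_walk)
       (auto simp: stay_Suc indicator_def out)
  with step show ?case
    by (simp only: expectation_walk_Suc_stay[OF I])
qed

lemma expectation_walk_sq_stay_le:
  assumes I [measurable]: "I \<in> sets borel"
  shows "expectation (\<lambda>\<omega>. (walk n \<omega>)\<^sup>2 * indicator (stay I n) \<omega>)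
    \<le> expectation (\<lambda>\<omega>. (Y 1 \<omega>)\<^sup>2) * (\<Sum>k<n. prob (stay I k))"
proof (induction n)
  case (Suc n)
  have "expectation (\<lambda>\<omega>. (walk (Suc n) \<omega>)\<^sup>2 * indicator (stay I (Suc n)) \<omega>)
    \<le> expectation (\<lambda>\<omega>. (walk (Suc n) \<omega>)\<^sup>2 * indicator (stay I n) \<omega>)"
    by (intro integral_mono integrable_real_mult_indicator square_integrable_walk)
       (auto simp: stay_Suc indicator_def)
  with Suc show ?case
    by (simp only: expectation_walk_Suc_sq_stay[OF I]) (simp add: distrib_left)
qed simp

lemma expectation_walk_stay_sq_le:
  assumes I [measurable]: "I \<in> sets borel"
  shows "(expectation (\<lambda>\<omega>. walk n \<omega> * indicator (stay I n) \<omega>))\<^sup>2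
    \<le> expectation (\<lambda>\<omega>. (walk n \<omega>)\<^sup>2 * indicator (stay I n) \<omega>) * prob (stay I n)"
proof -
  let ?J = "indicator (stay I n) :: 'a \<Rightarrow> real"
  let ?a = "expectation (\<lambda>\<omega>. walk n \<omega> * ?J \<omega>)"
  let ?V = "expectation (\<lambda>\<omega>. (walk n \<omega>)\<^sup>2 * ?J \<omega>)"
  let ?p = "prob (stay I n)"
  have int: "integrable M (\<lambda>\<omega>. walk n \<omega> * ?J \<omega>)" "integrable M (\<lambda>\<omega>. (walk n \<omega>)\<^sup>2 * ?J \<omega>)"
      "integrable M ?J"
    by (intro integrable_real_mult_indicator integrable_walk square_integrable_walk sets_stay I)+
       (simp add: integrable_indicator_iff less_top[symmetric])
  have quad: "0 \<le> ?V - 2 * t * ?a + t\<^sup>2 * ?p" for t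
  proof -
    have "0 \<le> expectation (\<lambda>\<omega>. (walk n \<omega> - t)\<^sup>2 * ?J \<omega>)"
      by (intro integral_nonneg_AE) auto
    also have "(\<lambda>\<omega>. (walk n \<omega> - t)\<^sup>2 * ?J \<omega>)
        = (\<lambda>\<omega>. (walk n \<omega>)\<^sup>2 * ?J \<omega> - (2 * t) * (walk n \<omega> * ?J \<omega>) + t\<^sup>2 * ?J \<omega>)"
      by (auto simp: fun_eq_iff power2_eq_square algebra_simps)
    also have "expectation \<dots> = ?V - 2 * t * ?a + t\<^sup>2 * ?p"
      using int by simp
    finally show ?thesis .
  qed
  show ?thesis
    by (rule discriminant_nonpos_if_nonneg[OF quad]) (auto intro!: integral_nonneg_AE)
qed

lemma expectation_pos_part:
  assumes [measurable]: "I \<in> sets borel" and "{0<..} \<subseteq> I" "I \<subseteq> {0..}"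
  shows "expectation (\<lambda>\<omega>. Y 1 \<omega> * indicator I (Y 1 \<omega>)) > 0"
proof -
  note [measurable] = measurable_Y[OF order_refl]
  have "y * indicator I y = (\<bar>y\<bar> + y) / 2" for y
    using assms(2,3) by (cases y "0 :: real" rule: linorder_cases) (auto simp: indicator_def)
  then have eq: "(\<lambda>\<omega>. Y 1 \<omega> * indicator I (Y 1 \<omega>)) = (\<lambda>\<omega>. (\<bar>Y 1 \<omega>\<bar> + Y 1 \<omega>) / 2)"
    by (simp only:)
  have "expectation (\<lambda>\<omega>. \<bar>Y 1 \<omega>\<bar>) \<noteq> 0"
  proof
    assume "expectation (\<lambda>\<omega>. \<bar>Y 1 \<omega>\<bar>) = 0"
    then have "AE \<omega> in M. Y 1 \<omega> = 0"
      using integral_nonneg_eq_0_iff_AE[of M "\<lambda>\<omega>. \<bar>Y 1 \<omega>\<bar>"] integrable_Y1 by simp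
    then have "expectation (\<lambda>\<omega>. (Y 1 \<omega>)\<^sup>2) = expectation (\<lambda>\<omega>. 0)"
      by (intro integral_cong_AE) auto
    then show False using var_pos by simp
  qed
  moreover have "expectation (\<lambda>\<omega>. \<bar>Y 1 \<omega>\<bar>) \<ge> 0" by simp
  ultimately have "expectation (\<lambda>\<omega>. \<bar>Y 1 \<omega>\<bar>) > 0" by linarith
  then show ?thesis
    unfolding eq using integrable_Y1 mean_zero by simp
qed

lemma stay_mult_sum_stay_ge:
  assumes I: "I \<in> sets borel" "{0<..} \<subseteq> I" "I \<subseteq> {0..}"
  obtains \<kappa> where "\<kappa> > 0"
    and "\<And>n. n \<ge> 1 \<Longrightarrow> \<kappa> \<le> prob (stay I n) * (\<Sum>k<n. prob (stay I k))"
proof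
  let ?m = "expectation (\<lambda>\<omega>. Y 1 \<omega> * indicator I (Y 1 \<omega>))"
  let ?v = "expectation (\<lambda>\<omega>. (Y 1 \<omega>)\<^sup>2)"
  have m: "?m > 0" using expectation_pos_part[OF I] .
  then show "?m\<^sup>2 / ?v > 0" using var_pos by simp
  fix n :: nat assume "n \<ge> 1"
  have out: "x \<le> 0" if "x \<notin> I" for x
    using that I(2) by (meson greaterThan_iff not_le subsetD)
  have "?m\<^sup>2 \<le> (expectation (\<lambda>\<omega>. walk n \<omega> * indicator (stay I n) \<omega>))\<^sup>2"
    using m I out \<open>n \<ge> 1\<close> by (intro power_mono expectation_walk_stay_ge) auto
  also have "\<dots> \<le> expectation (\<lambda>\<omega>. (walk n \<omega>)\<^sup>2 * indicator (stay I n) \<omega>) * prob (stay I n)"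
    by (rule expectation_walk_stay_sq_le[OF I(1)])
  also have "\<dots> \<le> (?v * (\<Sum>k<n. prob (stay I k))) * prob (stay I n)"
    by (intro mult_right_mono expectation_walk_sq_stay_le I) auto
  finally show "?m\<^sup>2 / ?v \<le> prob (stay I n) * (\<Sum>k<n. prob (stay I k))"
    using var_pos by (simp add: field_simps)
qed

lemma distr_Y_reindex:
  fixes n :: nat
  assumes "inj_on \<pi> {1..n}" "\<pi> \<in> {1..n} \<rightarrow> {1..}"
  shows "distr M (PiM {1..n} (\<lambda>_. borel)) (\<lambda>\<omega>. \<lambda>i\<in>{1..n}. Y (\<pi> i) \<omega>)
    = PiM {1..n} (\<lambda>_. distr M borel (Y 1))"
proof -
  let ?\<mu> = "distr M borel (Y 1)" and ?B = "\<lambda>A. PiM A (\<lambda>_::nat. borel :: real measure)"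
  let ?g = "\<lambda>f. \<lambda>i\<in>{1..n}. f (\<pi> i) :: real"
  have meas: "(\<lambda>\<omega>. \<lambda>i\<in>{1..}. Y i \<omega>) \<in> measurable M (?B {1..})"
    by (intro measurable_restrict measurable_Y) auto
  have g: "?g \<in> measurable (?B {1..}) (?B {1..n})"
    using assms(2) by (intro measurable_restrict measurable_component_singleton) auto
  have "distr M (?B {1..}) (\<lambda>\<omega>. \<lambda>i\<in>{1..}. Y i \<omega>) = PiM {1..} (\<lambda>i. distr M borel (Y i))"
    using indep measurable_Y by (subst (asm) indep_vars_iff_distr_eq_PiM') auto
  also have "\<dots> = PiM {1..} (\<lambda>_. ?\<mu>)"
    by (intro PiM_cong ident) auto
  finally have law: "distr M (?B {1..}) (\<lambda>\<omega>. \<lambda>i\<in>{1..}. Y i \<omega>) = PiM {1..} (\<lambda>_. ?\<mu>)" .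
  have "distr M (?B {1..n}) (\<lambda>\<omega>. \<lambda>i\<in>{1..n}. Y (\<pi> i) \<omega>)
      = distr M (?B {1..n}) (?g \<circ> (\<lambda>\<omega>. \<lambda>i\<in>{1..}. Y i \<omega>))"
    using assms(2) by (intro distr_cong) (auto simp: fun_eq_iff restrict_def Pi_iff)
  also have "\<dots> = distr (distr M (?B {1..}) (\<lambda>\<omega>. \<lambda>i\<in>{1..}. Y i \<omega>)) (?B {1..n}) ?g"
    by (rule distr_distr[OF g meas, symmetric])
  also have "\<dots> = distr (PiM {1..} (\<lambda>_. ?\<mu>)) (PiM {1..n} (\<lambda>_. ?\<mu>)) ?g"
    unfolding law by (intro distr_cong sets_PiM_cong) auto
  also have "\<dots> = PiM {1..n} (\<lambda>_. ?\<mu>)"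
    using assms by (intro distr_PiM_reindex prob_space_distr measurable_Y) auto
  finally show ?thesis .
qed

lemma sets_path_stay:
  fixes n :: nat
  assumes I [measurable]: "I \<in> sets borel"
  shows "{f \<in> space (PiM {1..n} (\<lambda>_. borel)). \<forall>k\<in>{1..n}. (\<Sum>i\<in>{1..k}. f i :: real) \<in> I}
    \<in> sets (PiM {1..n} (\<lambda>_. borel))"
proof (intro sets.sets_Collect_finite_All)
  fix k assume "k \<in> {1..n}"
  then have [measurable]: "(\<lambda>f. \<Sum>i\<in>{1..k}. f i :: real) \<in> borel_measurable (PiM {1..n} (\<lambda>_. borel))"
    by (intro measurable_partial_sum) auto
  show "{f \<in> space (PiM {1..n} (\<lambda>_. borel)). (\<Sum>i\<in>{1..k}. f i :: real) \<in> I}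
    \<in> sets (PiM {1..n} (\<lambda>_. borel))"
    by measurable
qed simp

lemma prob_stay_reindex:
  assumes I [measurable]: "I \<in> sets borel"
    and \<pi>: "inj_on \<pi> {1..n}" "\<pi> \<in> {1..n} \<rightarrow> {1..}"
  shows "prob {\<omega> \<in> space M. \<forall>k\<in>{1..n}. (\<Sum>i\<in>{1..k}. Y (\<pi> i) \<omega>) \<in> I} = prob (stay I n)"
proof -
  let ?A = "{f \<in> space (PiM {1..n} (\<lambda>_. borel)). \<forall>k\<in>{1..n}. (\<Sum>i\<in>{1..k}. f i :: real) \<in> I}"
  have *: "prob {\<omega> \<in> space M. \<forall>k\<in>{1..n}. (\<Sum>i\<in>{1..k}. Y (\<rho> i) \<omega>) \<in> I}
      = measure (PiM {1..n} (\<lambda>_. distr M borel (Y 1))) ?A"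
    if \<rho>: "inj_on \<rho> {1..n}" "\<rho> \<in> {1..n} \<rightarrow> {1..}" for \<rho>
  proof -
    have meas: "(\<lambda>\<omega>. \<lambda>i\<in>{1..n}. Y (\<rho> i) \<omega>) \<in> measurable M (PiM {1..n} (\<lambda>_. borel))"
      using \<rho> by (intro measurable_restrict measurable_Y) auto
    have "{\<omega> \<in> space M. \<forall>k\<in>{1..n}. (\<Sum>i\<in>{1..k}. Y (\<rho> i) \<omega>) \<in> I}
        = (\<lambda>\<omega>. \<lambda>i\<in>{1..n}. Y (\<rho> i) \<omega>) -` ?A \<inter> space M"
      by (auto simp: space_PiM)
    then show ?thesis
      by (simp only: measure_distr[OF meas sets_path_stay[OF I], symmetric] distr_Y_reindex[OF \<rho>])
  qed
  show ?thesis
    unfolding stay_def walk_def using *[OF \<pi>] *[of "\<lambda>i. i"] by simp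
qed


text \<open>The sums over \<open>{j..k}\<close> are the partial sums of the time-reversed walk.\<close>
lemma prob_block_stay:
  fixes k m :: nat
  assumes I [measurable]: "I \<in> sets borel" and J [measurable]: "J \<in> sets borel"
  shows "{\<omega> \<in> space M. (\<forall>j\<in>{1..k}. (\<Sum>i\<in>{j..k}. Y i \<omega>) \<in> I)
      \<and> (\<forall>j\<in>{1..m}. (\<Sum>i\<in>{k+1..k+j}. Y i \<omega>) \<in> J)} \<in> events" (is "?E \<in> events")
    and "prob {\<omega> \<in> space M. (\<forall>j\<in>{1..k}. (\<Sum>i\<in>{j..k}. Y i \<omega>) \<in> I)
      \<and> (\<forall>j\<in>{1..m}. (\<Sum>i\<in>{k+1..k+j}. Y i \<omega>) \<in> J)} = prob (stay I k) * prob (stay J m)"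
proof -
  let ?P = "PiM {1..k} (\<lambda>_. borel :: real measure)" and ?Q = "PiM {k+1..k+m} (\<lambda>_. borel :: real measure)"
  let ?A = "{f \<in> space ?P. \<forall>j\<in>{1..k}. (\<Sum>i\<in>{j..k}. f i) \<in> I}"
  let ?B = "{f \<in> space ?Q. \<forall>j\<in>{1..m}. (\<Sum>i\<in>{k+1..k+j}. f i) \<in> J}"
  let ?X = "\<lambda>\<omega>. \<lambda>i\<in>{1..k}. Y i \<omega>" and ?Z = "\<lambda>\<omega>. \<lambda>i\<in>{k+1..k+m}. Y i \<omega>"
  have A: "?A \<in> sets ?P"
  proof (intro sets.sets_Collect_finite_All)
    fix j assume "j \<in> {1..k}"
    then have [measurable]: "(\<lambda>f. \<Sum>i\<in>{j..k}. f i :: real) \<in> borel_measurable ?P"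
      by (intro measurable_partial_sum) auto
    show "{f \<in> space ?P. (\<Sum>i\<in>{j..k}. f i) \<in> I} \<in> sets ?P"
      by measurable
  qed simp
  have B: "?B \<in> sets ?Q"
  proof (intro sets.sets_Collect_finite_All)
    fix j assume "j \<in> {1..m}"
    then have [measurable]: "(\<lambda>f. \<Sum>i\<in>{k+1..k+j}. f i :: real) \<in> borel_measurable ?Q"
      by (intro measurable_partial_sum) auto
    show "{f \<in> space ?Q. (\<Sum>i\<in>{k+1..k+j}. f i) \<in> J} \<in> sets ?Q"
      by measurable
  qed simp
  have ind: "indep_var ?P ?X ?Q ?Z"
    by (intro indep_var_restrict[OF indep]) auto
  have XA: "?X -` ?A \<inter> space M = {\<omega> \<in> space M. \<forall>j\<in>{1..k}. (\<Sum>i\<in>{j..k}. Y i \<omega>) \<in> I}"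
    by (auto simp: space_PiM)
  have ZB: "?Z -` ?B \<inter> space M = {\<omega> \<in> space M. \<forall>j\<in>{1..m}. (\<Sum>i\<in>{k+1..k+j}. Y i \<omega>) \<in> J}"
    by (auto simp: space_PiM)
  have E: "?E = (?X -` ?A \<inter> space M) \<inter> (?Z -` ?B \<inter> space M)"
    unfolding XA ZB by auto
  show "?E \<in> events"
    unfolding E by (intro sets.Int measurable_sets[OF indep_var_rv1[OF ind] A]
        measurable_sets[OF indep_var_rv2[OF ind] B])
  have rev: "(\<Sum>i\<in>{j..k}. Y i \<omega>) = (\<Sum>i\<in>{1..k + 1 - j}. Y (k + 1 - i) \<omega>)" if "j \<in> {1..k}" for j \<omega>
    using that by (intro sum.reindex_bij_witness[of _ "\<lambda>i. k + 1 - i" "\<lambda>i. k + 1 - i"]) auto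
  have all_rev: "(\<forall>j\<in>{1..k}. P (k + 1 - j)) \<longleftrightarrow> (\<forall>j\<in>{1..k}. P j)" for P
  proof (intro iffI ballI)
    fix j assume "\<forall>j\<in>{1..k}. P (k + 1 - j)" "j \<in> {1..k}"
    then show "P j" by (auto dest!: bspec[of _ _ "k + 1 - j"])
  next
    fix j assume "\<forall>j\<in>{1..k}. P j" "j \<in> {1..k}"
    moreover from this have "k + 1 - j \<in> {1..k}" by auto
    ultimately show "P (k + 1 - j)" by blast
  qed
  have shift: "(\<Sum>i\<in>{k+1..k+j}. Y i \<omega>) = (\<Sum>i\<in>{1..j}. Y (k + i) \<omega>)" for j \<omega>
    by (intro sum.reindex_bij_witness[of _ "\<lambda>i. k + i" "\<lambda>i. i - k"]) auto
  have "?E = (\<lambda>\<omega>. (?X \<omega>, ?Z \<omega>)) -` (?A \<times> ?B) \<inter> space M"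
    unfolding E by auto
  then have "prob ?E = prob (?X -` ?A \<inter> space M) * prob (?Z -` ?B \<inter> space M)"
    using indep_varD[OF ind A B] by simp
  also have "?X -` ?A \<inter> space M
      = {\<omega> \<in> space M. \<forall>j\<in>{1..k}. (\<Sum>i\<in>{1..k + 1 - j}. Y (k + 1 - i) \<omega>) \<in> I}"
    unfolding XA using rev by auto
  also have "\<dots> = {\<omega> \<in> space M. \<forall>j\<in>{1..k}. (\<Sum>i\<in>{1..j}. Y (k + 1 - i) \<omega>) \<in> I}"
    by (subst all_rev[of "\<lambda>j. (\<Sum>i\<in>{1..j}. Y (k + 1 - i) _) \<in> I"]) (rule refl)
  also have "prob \<dots> = prob (stay I k)"
    by (rule prob_stay_reindex[OF I]) (auto simp: inj_on_def)
  also have "prob (?Z -` ?B \<inter> space M) = prob (stay J m)"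
    unfolding ZB shift by (rule prob_stay_reindex[OF J]) (auto simp: inj_on_def)
  finally show "prob ?E = prob (stay I k) * prob (stay J m)" .
qed

lemma prob_stay_antimono: "I \<in> sets borel \<Longrightarrow> m \<le> n \<Longrightarrow> prob (stay I n) \<le> prob (stay I m)"
  by (intro finite_measure_mono sets_stay) (auto simp: stay_def)

lemma prob_stay_mono: "J \<in> sets borel \<Longrightarrow> I \<subseteq> J \<Longrightarrow> prob (stay I n) \<le> prob (stay J n)"
  by (intro finite_measure_mono sets_stay) (auto simp: stay_def)

lemma prob_stay_nonpos_mult_sum_le_1:
  "prob (stay {..0} n) * (\<Sum>k\<le>n. prob (stay {0<..} k)) \<le> 1"
proof -
  define E where "E k = {\<omega> \<in> space M. (\<forall>j\<in>{1..k}. (\<Sum>i\<in>{j..k}. Y i \<omega>) \<in> {0<..})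
      \<and> (\<forall>j\<in>{1..n-k}. (\<Sum>i\<in>{k+1..k+j}. Y i \<omega>) \<in> {..0})}" for k
  have E: "E k \<in> events" "prob (E k) = prob (stay {0<..} k) * prob (stay {..0} (n - k))" for k
    unfolding E_def by (rule prob_block_stay; simp)+
  \<comment> \<open>\<open>E k\<close> says that \<open>k\<close> is the first time at which the maximum up to time \<open>n\<close> is attained.\<close>
  have disj: "E k \<inter> E l = {}" if "k < l" "l \<le> n" for k l
  proof -
    have "(\<Sum>i\<in>{k+1..l}. Y i \<omega>) \<in> {..0}" if "\<omega> \<in> E k" for \<omega>
      using that \<open>k < l\<close> \<open>l \<le> n\<close> unfolding E_def by (auto dest!: bspec[of _ _ "l - k"])
    moreover have "(\<Sum>i\<in>{k+1..l}. Y i \<omega>) \<in> {0<..}" if "\<omega> \<in> E l" for \<omega>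
      using that \<open>k < l\<close> unfolding E_def by (auto dest!: bspec[of _ _ "k + 1"])
    ultimately show ?thesis by fastforce
  qed
  have "prob (stay {..0} n) * (\<Sum>k\<le>n. prob (stay {0<..} k))
      = (\<Sum>k\<le>n. prob (stay {0<..} k) * prob (stay {..0} n))"
    by (simp add: sum_distrib_left mult.commute)
  also have "\<dots> \<le> (\<Sum>k\<le>n. prob (E k))"
    unfolding E by (intro sum_mono mult_left_mono prob_stay_antimono) auto
  also have "\<dots> = prob (\<Union>k\<le>n. E k)"
  proof (rule finite_measure_finite_Union[symmetric])
    show "disjoint_family_on E {..n}"
      unfolding disjoint_family_on_def
      by (metis Int_commute atMost_iff disj linorder_neq_iff)
  qed (use E in auto)
  also have "\<dots> \<le> 1" by simp
  finally show ?thesis .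
qed

lemma prob_stay_nonpos_le:
  obtains C where "C > 0" and "\<And>n. prob (stay {..0} n) \<le> C / sqrt (real n + 1)"
proof -
  obtain \<kappa> where \<kappa>: "\<kappa> > 0"
      "\<And>n. n \<ge> 1 \<Longrightarrow> \<kappa> \<le> prob (stay {0<..} n) * (\<Sum>k<n. prob (stay {0<..} k))"
    by (rule stay_mult_sum_stay_ge[of "{0<..}"]) auto
  show ?thesis
  proof (rule that[of "1 / sqrt \<kappa>"])
    fix n
    let ?q = "prob (stay {..0} n)" and ?R = "\<Sum>k<Suc n. prob (stay {0<..} k)"
    have "\<kappa> * real (Suc n) \<le> ?R\<^sup>2"
      using \<kappa> by (intro sum_square_ge_linear) (auto simp: prob_space)
    then have "sqrt (\<kappa> * real (Suc n)) \<le> ?R"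
      by (intro real_le_lsqrt sum_nonneg) auto
    then have "?q * sqrt (\<kappa> * real (Suc n)) \<le> ?q * ?R"
      by (intro mult_left_mono) auto
    also have "\<dots> \<le> 1"
      using prob_stay_nonpos_mult_sum_le_1[of n] by (simp only: lessThan_Suc_atMost)
    finally have "?q * (sqrt \<kappa> * sqrt (real n + 1)) \<le> 1"
      by (simp add: real_sqrt_mult add.commute)
    then show "?q \<le> 1 / sqrt \<kappa> / sqrt (real n + 1)"
      using \<kappa>(1) by (simp add: pos_le_divide_eq)
  qed (use \<kappa> in simp)
qed

lemma iid_walk_uminus: "iid_walk M (\<lambda>n \<omega>. - Y n \<omega>)"
proof
  show "indep_vars (\<lambda>_. borel) (\<lambda>n \<omega>. - Y n \<omega>) {1..}"
    using indep_vars_compose2[OF indep, of "\<lambda>_ y. - y" "\<lambda>_. borel"] by simp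
  show "distr M borel (\<lambda>\<omega>. - Y n \<omega>) = distr M borel (\<lambda>\<omega>. - Y 1 \<omega>)" if "n \<ge> 1" for n
  proof -
    have "distr M borel (\<lambda>\<omega>. - Y k \<omega>) = distr (distr M borel (Y k)) borel uminus" if "k \<ge> 1" for k
      using that by (subst distr_distr) (auto simp: o_def intro: measurable_Y)
    then show ?thesis using ident[OF that] that by (metis order_refl)
  qed
qed (use integrable_Y1 mean_zero integrable_Y1_sq var_pos in auto)

lemma prob_stay_nonpos_ge:
  obtains c where "c > 0" and "\<And>n. n \<ge> 1 \<Longrightarrow> c / sqrt (real n) \<le> prob (stay {..0} n)"
proof -
  interpret neg: iid_walk M "\<lambda>n \<omega>. - Y n \<omega>" by (rule iid_walk_uminus)
  have stay_eq: "neg.stay {0..} n = stay {..0} n" for n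
    by (auto simp: neg.stay_def stay_def neg.walk_def walk_def sum_negf)
  obtain \<kappa> where \<kappa>: "\<kappa> > 0"
      "\<And>n. n \<ge> 1 \<Longrightarrow> \<kappa> \<le> prob (stay {..0} n) * (\<Sum>k<n. prob (stay {..0} k))"
    by (rule neg.stay_mult_sum_stay_ge[of "{0..}", unfolded stay_eq]) auto
  obtain C where C: "C > 0" "\<And>n. prob (stay {..0} n) \<le> C / sqrt (real n + 1)"
    using prob_stay_nonpos_le by blast
  show ?thesis
  proof (rule that[of "\<kappa> / (2 * C)"])
    fix n :: nat assume n: "n \<ge> 1"
    have "(\<Sum>k<n. prob (stay {..0} k)) \<le> C * (\<Sum>k<n. 1 / sqrt (real k + 1))"
      unfolding sum_distrib_left using C(2) by (intro sum_mono) simp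
    also have "\<dots> \<le> C * (2 * sqrt (real n))"
      using C(1) by (intro mult_left_mono sum_inverse_sqrt_le) simp
    finally have "prob (stay {..0} n) * (\<Sum>k<n. prob (stay {..0} k))
        \<le> prob (stay {..0} n) * (C * (2 * sqrt (real n)))"
      by (intro mult_left_mono) auto
    with \<kappa>(2)[OF n] have "\<kappa> \<le> prob (stay {..0} n) * (C * (2 * sqrt (real n)))"
      by linarith
    then show "\<kappa> / (2 * C) / sqrt (real n) \<le> prob (stay {..0} n)"
      using C(1) n by (simp add: field_simps)
  qed (use \<kappa> C in simp)
qed

lemma prob_step_down_pos:
  obtains \<delta> where "\<delta> > 0" and "prob (stay {..-\<delta>} 1) > 0"
proof -
  interpret neg: iid_walk M "\<lambda>n \<omega>. - Y n \<omega>" by (rule iid_walk_uminus)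
  note [measurable] = measurable_Y[OF order_refl]
  let ?m = "expectation (\<lambda>\<omega>. - Y 1 \<omega> * indicator {0..} (- Y 1 \<omega>))"
  have m: "?m > 0" by (rule neg.expectation_pos_part) auto
  have stay: "stay {..- (?m / 2)} 1 = {\<omega> \<in> space M. Y 1 \<omega> \<le> - (?m / 2)}"
    by (auto simp: stay_def walk_def)
  have "prob (stay {..- (?m / 2)} 1) \<noteq> 0"
  proof
    assume "prob (stay {..- (?m / 2)} 1) = 0"
    then have "AE \<omega> in M. \<not> Y 1 \<omega> \<le> - (?m / 2)"
      unfolding stay by (subst (asm) prob_Collect_eq_0) auto
    then have "AE \<omega> in M. - Y 1 \<omega> * indicator {0..} (- Y 1 \<omega>) \<le> ?m / 2"
      by eventually_elim (use m in \<open>auto simp: indicator_def\<close>)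
    moreover have "integrable M (\<lambda>\<omega>. - Y 1 \<omega> * indicator {0..} (- Y 1 \<omega>))"
      by (rule Bochner_Integration.integrable_bound[OF integrable_Y1]) (auto simp: indicator_def)
    ultimately have "?m \<le> expectation (\<lambda>_. ?m / 2)"
      by (intro integral_mono_AE) auto
    then show False using m by (simp add: prob_space)
  qed
  then show ?thesis
    using m by (intro that[of "?m / 2"]) (auto simp: zero_less_measure_iff)
qed

lemma prob_stay_shift_level:
  assumes "c \<ge> 0"
  shows "prob (stay {..-\<delta>} 1) * prob (stay {..c} n) \<le> prob (stay {..c - \<delta>} (Suc n))"
proof -
  let ?E = "{\<omega> \<in> space M. (\<forall>j\<in>{1..1}. (\<Sum>i\<in>{j..1}. Y i \<omega>) \<in> {..-\<delta>})
      \<and> (\<forall>j\<in>{1..n}. (\<Sum>i\<in>{1+1..1+j}. Y i \<omega>) \<in> {..c})}"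
  have "?E \<subseteq> stay {..c - \<delta>} (Suc n)"
  proof
    fix \<omega> assume \<omega>: "\<omega> \<in> ?E"
    have "walk k \<omega> \<le> c - \<delta>" if "k \<in> {1..Suc n}" for k
    proof (cases "k = 1")
      case True
      then show ?thesis using \<omega> \<open>c \<ge> 0\<close> by (simp add: walk_def)
    next
      case False
      with that have "k - 1 \<in> {1..n}" "1 + (k - 1) = k" by auto
      with \<omega> have "(\<Sum>i\<in>{1+1..k}. Y i \<omega>) \<le> c" by force
      moreover have "walk k \<omega> = Y 1 \<omega> + (\<Sum>i\<in>{1+1..k}. Y i \<omega>)"
        using that by (simp add: walk_def sum.atLeast_Suc_atMost)
      ultimately show ?thesis using \<omega> by simp
    qed
    with \<omega> show "\<omega> \<in> stay {..c - \<delta>} (Suc n)" by (simp add: stay_def)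
  qed
  then have "prob ?E \<le> prob (stay {..c - \<delta>} (Suc n))"
    by (intro finite_measure_mono sets_stay) auto
  then show ?thesis by (subst (asm) prob_block_stay) auto
qed

lemma prob_stay_le:
  obtains C where "\<And>n. prob (stay {..x} n) \<le> C / sqrt (real n + 1)"
proof -
  obtain \<delta> where \<delta>: "\<delta> > 0" "prob (stay {..-\<delta>} 1) > 0" using prob_step_down_pos .
  let ?p = "prob (stay {..-\<delta>} 1)"
  obtain C where C: "C > 0" "\<And>n. prob (stay {..0} n) \<le> C / sqrt (real n + 1)"
    using prob_stay_nonpos_le by blast
  have level: "?p ^ m * prob (stay {..real m * \<delta>} n) \<le> prob (stay {..0} n)" for m n
  proof (induction m arbitrary: n)
    case (Suc m)
    have "?p * prob (stay {..real (Suc m) * \<delta>} n) \<le> prob (stay {..real m * \<delta>} (Suc n))"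
      using prob_stay_shift_level[of "real (Suc m) * \<delta>" \<delta> n] \<delta> by (simp add: algebra_simps)
    also have "\<dots> \<le> prob (stay {..real m * \<delta>} n)"
      by (intro prob_stay_antimono) auto
    finally have "?p ^ m * (?p * prob (stay {..real (Suc m) * \<delta>} n))
        \<le> ?p ^ m * prob (stay {..real m * \<delta>} n)"
      by (intro mult_left_mono) auto
    with Suc[of n] show ?case by (simp add: mult_ac)
  qed simp
  obtain m where m: "x \<le> real m * \<delta>"
    using \<delta>(1) ex_less_of_nat_mult less_imp_le by blast
  show ?thesis
  proof (rule that[of "C / ?p ^ m"])
    fix n
    have "?p ^ m * prob (stay {..x} n) \<le> ?p ^ m * prob (stay {..real m * \<delta>} n)"
      using m by (intro mult_left_mono prob_stay_mono) auto
    also have "\<dots> \<le> C / sqrt (real n + 1)"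
      using level[of m n] C(2)[of n] by linarith
    finally show "prob (stay {..x} n) \<le> C / ?p ^ m / sqrt (real n + 1)"
      using \<delta>(2) by (simp add: field_simps)
  qed
qed

lemma ar2_eq_walk:
  assumes "a1 + a2 = 1"
  shows "ar2 a1 a2 Y (Suc n) \<omega> + a2 * ar2 a1 a2 Y n \<omega> = walk (Suc n) \<omega>"
proof (induction n)
  case 0
  show ?case by (simp add: walk_Suc One_nat_def)
next
  case (Suc n)
  let ?u = "ar2 a1 a2 Y (Suc n) \<omega>"
  have "a1 * ?u + a2 * ?u = ?u"
    using assms by (simp flip: distrib_right)
  with Suc show ?case by (simp add: walk_Suc)
qed

lemma sets_ar2_le: "{\<omega> \<in> space M. \<forall>n\<in>{1..N}. ar2 a1 a2 Y n \<omega> \<le> x} \<in> events"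
proof -
  have [measurable]: "ar2 a1 a2 Y n \<in> borel_measurable M" for n
    by (induction n rule: induct_nat_012) (auto intro!: borel_measurable_add borel_measurable_times measurable_Y)
  show ?thesis by measurable
qed

lemma persist_prob_le:
  assumes "a1 + a2 = 1" "a2 > 0" "x \<ge> 0"
  shows "persist_prob M a1 a2 Y N x \<le> prob (stay {..(1 + a2) * x} N)"
  unfolding persist_prob_def
proof (intro finite_measure_mono sets_stay subsetI)
  fix \<omega> assume \<omega>: "\<omega> \<in> {\<omega> \<in> space M. \<forall>n\<in>{1..N}. ar2 a1 a2 Y n \<omega> \<le> x}"
  have "walk k \<omega> \<le> (1 + a2) * x" if "k \<in> {1..N}" for k
  proof -
    obtain n where n: "k = Suc n" using \<open>k \<in> {1..N}\<close> by (cases k) auto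
    have "ar2 a1 a2 Y n \<omega> \<le> x"
      using \<omega> that n \<open>x \<ge> 0\<close> by (cases n) auto
    then have "a2 * ar2 a1 a2 Y n \<omega> \<le> a2 * x"
      using \<open>a2 > 0\<close> by (intro mult_left_mono) auto
    moreover have "ar2 a1 a2 Y (Suc n) \<omega> \<le> x"
      using \<omega> that n by auto
    ultimately show ?thesis
      using ar2_eq_walk[OF assms(1), of n \<omega>] n by (simp add: algebra_simps)
  qed
  with \<omega> show "\<omega> \<in> stay {..(1 + a2) * x} N" by (simp add: stay_def)
qed simp

lemma persist_prob_ge:
  assumes "a1 + a2 = 1" "a2 < 0" "x \<ge> 0"
  shows "prob (stay {..0} N) \<le> persist_prob M a1 a2 Y N x"
  unfolding persist_prob_def
proof (intro finite_measure_mono sets_ar2_le subsetI)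
  fix \<omega> assume \<omega>: "\<omega> \<in> stay {..0} N"
  have "k \<le> N \<Longrightarrow> ar2 a1 a2 Y k \<omega> \<le> 0" for k
  proof (induction k)
    case (Suc k)
    then have "a2 * ar2 a1 a2 Y k \<omega> \<ge> 0"
      using \<open>a2 < 0\<close> by (intro mult_nonpos_nonpos) auto
    moreover have "walk (Suc k) \<omega> \<le> 0"
      using \<omega> Suc.prems by (auto simp: stay_def)
    ultimately show ?case
      using ar2_eq_walk[OF assms(1), of k \<omega>] by linarith
  qed simp
  with \<omega> \<open>x \<ge> 0\<close> show "\<omega> \<in> {\<omega> \<in> space M. \<forall>n\<in>{1..N}. ar2 a1 a2 Y n \<omega> \<le> x}"
    by (force simp: stay_def)
qed

end

theorem mainTheorem18:
  fixes M :: "'a measure" and Y :: "nat \<Rightarrow> 'a \<Rightarrow> real" and a1 a2 :: real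
  assumes "prob_space M"
    and rv: "\<And>n. n \<ge> 1 \<Longrightarrow> Y n \<in> borel_measurable M"
    and indep: "prob_space.indep_vars M (\<lambda>_. borel) Y {1..}"
    and ident: "\<And>n. n \<ge> 1 \<Longrightarrow> distr M borel (Y n) = distr M borel (Y 1)"
    and int1: "integrable M (Y 1)"
    and mean0: "prob_space.expectation M (Y 1) = 0"
    and int2: "integrable M (\<lambda>\<omega>. (Y 1 \<omega>)\<^sup>2)"
    and var_pos: "prob_space.expectation M (\<lambda>\<omega>. (Y 1 \<omega>)\<^sup>2) > 0"
    and sum1: "a1 + a2 = 1"
    and a2_bound: "\<bar>a2\<bar> < 1"
  shows "(a2 > 0 \<longrightarrow> (\<forall>x\<ge>0. (\<lambda>N. persist_prob M a1 a2 Y N x) \<in> O(\<lambda>N. 1 / sqrt (real N))))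
       \<and> (a2 < 0 \<longrightarrow> (\<forall>x\<ge>0. (\<lambda>N. 1 / sqrt (real N)) \<in> O(\<lambda>N. persist_prob M a1 a2 Y N x)))"
proof -
  interpret prob_space M by fact
  interpret iid_walk M Y
    using indep ident int1 mean0 int2 var_pos by unfold_locales
  show ?thesis
  proof (intro conjI impI allI)
    fix x :: real assume "a2 > 0" "x \<ge> 0"
    obtain C where C: "\<And>n. prob (stay {..(1 + a2) * x} n) \<le> C / sqrt (real n + 1)"
      using prob_stay_le[of "(1 + a2) * x"] by blast
    have "C \<ge> 0" using C[of 0] by (simp add: prob_space)
    show "(\<lambda>N. persist_prob M a1 a2 Y N x) \<in> O(\<lambda>N. 1 / sqrt (real N))"
    proof (rule bigoI[of _ C], rule eventually_sequentiallyI[of 1])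
      fix N :: nat assume "N \<ge> 1"
      have "persist_prob M a1 a2 Y N x \<le> C / sqrt (real N + 1)"
        using persist_prob_le[OF sum1 \<open>a2 > 0\<close> \<open>x \<ge> 0\<close>] C by (rule order_trans)
      also have "\<dots> \<le> C / sqrt (real N)"
        using \<open>C \<ge> 0\<close> \<open>N \<ge> 1\<close> by (intro divide_left_mono) auto
      finally show "norm (persist_prob M a1 a2 Y N x) \<le> C * norm (1 / sqrt (real N))"
        by (simp add: persist_prob_def)
    qed
  next
    fix x :: real assume "a2 < 0" "x \<ge> 0"
    obtain c where c: "c > 0" "\<And>n. n \<ge> 1 \<Longrightarrow> c / sqrt (real n) \<le> prob (stay {..0} n)"
      using prob_stay_nonpos_ge by blast
    show "(\<lambda>N. 1 / sqrt (real N)) \<in> O(\<lambda>N. persist_prob M a1 a2 Y N x)"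
    proof (rule bigoI[of _ "1 / c"], rule eventually_sequentiallyI[of 1])
      fix N :: nat assume "N \<ge> 1"
      have "c / sqrt (real N) \<le> persist_prob M a1 a2 Y N x"
        using c(2)[OF \<open>N \<ge> 1\<close>] persist_prob_ge[OF sum1 \<open>a2 < 0\<close> \<open>x \<ge> 0\<close>] by (rule order_trans)
      then show "norm (1 / sqrt (real N)) \<le> 1 / c * norm (persist_prob M a1 a2 Y N x)"
        using c(1) by (simp add: persist_prob_def field_simps)
    qed
  qed
qed

end
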